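(* Let $s=3$. For any $\mathfrak N\in\mathbb N$, any partition $\mathcal P_{\mathfrak N}=\{t_n\}_{n=0}^{\mathfrak N}$ of $[0,t_f]$, and any $n\in\{0,\dots,\mathfrak N-1\}$, the solution of the three-stage DIRK scheme $$v_{n,i}=u_n+\tau_n\sum_{j=1}^i a_{ij}\mathscr F_{n,j}\ (i=1,2,3),\qquad u_{n+1}=u_n+\tau_n\sum_{j=1}^3 b_j\mathscr F_{n,j},$$ with $a_{ii}>0$ for $i=1,2,3$, satisfies $$\tfrac12|u_{n+1}|^2+\mathcal Q(u_n,v_{n,1},v_{n,2},v_{n,3})-\tau_n\sum_{i=1}^3\nu_i\langle\mathscr F_{n,i},v_{n,i}\rangle=\tfrac12|u_n|^2,$$ where $\nu_i=\nu_{ii}+\sum_{j=i+1}^3\nu_{ij}$ for $i=1,2,3$, and $\mathcal Q$ is the quadratic form $$\begin{aligned}\mathcal Q(u_n,v_{n,1},v_{n,2},v_{n,3})&=\delta_1|v_{n,1}-u_n|^2+\delta_2|v_{n,2}-v_{n,1}|^2+\delta_3|v_{n,3}-v_{n,2}|^2\\&\quad-\frac{\nu_{12}}{a_{11}}(v_{n,1}-u_n,v_{n,2}-v_{n,1})-\frac{\nu_{13}}{a_{11}}(v_{n,1}-u_n,v_{n,3}-v_{n,1})\\&\quad-\frac{\nu_{23}}{a_{22}}(v_{n,2}-u_n,v_{n,3}-v_{n,2})+\frac{\nu_{23}a_{21}}{a_{11}a_{22}}(v_{n,1}-u_n,v_{n,3}-v_{n,2}),\end{aligned}$$ with the coefficients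 $\delta_i,\nu_{ij}$ (functions of the tableau) given in the context.
   Context: $\mathbb V\subset\mathbb H\subset\mathbb V^*$ is a Gelfand triple: $\mathbb H$ is a separable (real) Hilbert space with inner product $(\cdot,\cdot)$ and norm $|\cdot|$; $\mathbb V$ is a Banach space with dual $\mathbb V^*$ and duality pairing $\langle\cdot,\cdot\rangle$; every $v\in\mathbb H$ is identified with the element of $\mathbb V^*$ given by $\langle v,w\rangle=(v,w)$ for all $w\in\mathbb V$. Let $t_f>0$, $u_0\in\mathbb H$, $f:[0,t_f]\to\mathbb V^*$ and $\mathcal A:\mathbb V\to\mathbb V^*$; the problem approximated is $\frac{du}{dt}=f(t)-\mathcal A(u)$ on $(0,t_f]$, $u(0)=u_0$. Standing assumptions on $\mathcal A$: $\langle\mathcal A(w),w\rangle\ge0$ for all $w\in\mathbb V$, and (local solvability) for every $F\in\mathbb V^*$ there is $\beta>0$ such that for all $\gamma\in(0,\beta]$ the problem $v+\gamma\mathcal A(v)=F$ has a unique solution $v\in\mathbb V$. A partition is $0=t_0<\dots<t_{\mathfrak N}=t_f$ and $\tau_n=t_{n+1}-t_n$. The Runge-Kutta scheme has tableau with coefficient matrix $\mathbf A=[a_{ij}]$ (lower triangular, i.e. DIRK), weights $b_i\in[0,1]$ and nodes $c_i\in[0,1]$. Here $\mathscr F_{n,j}=f(t_n+c_j\tau_n)-\mathcal A(v_{n,j})$. The scheme equations hold in $\mathbb V^*$, with $u_n\in\mathbb H$, stages $v_{n,i}\in\mathbb V$ and $u_{n+1}\in\mathbb H$. Coefficients: $$\lambda_1=\frac{b_1}{a_{11}}-\frac{b_2a_{21}}{a_{11}a_{22}}-\frac{b_3a_{31}}{a_{11}a_{33}}+\frac{b_3a_{32}a_{21}}{a_{11}a_{22}a_{33}},\quad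 \lambda_2=\frac{b_2}{a_{22}}-\frac{b_3a_{32}}{a_{22}a_{33}},\quad \lambda_3=\frac{b_3}{a_{33}},$$ $$\begin{aligned}\delta_1&=\tfrac12(\lambda_1+\lambda_2+\lambda_3)(2-\lambda_1-\lambda_2-\lambda_3),\quad \delta_2=\tfrac12(\lambda_2+\lambda_3)(2-\lambda_2-\lambda_3),\quad \delta_3=\tfrac12\lambda_3(2-\lambda_3),\\ \nu_{11}&=a_{11}\big(\lambda_1(1-\lambda_2-\lambda_3)+(2-\lambda_2-\lambda_3)(\lambda_2+\lambda_3)\big),\\ \nu_{22}&=a_{22}\big(\lambda_2(1-\lambda_3)+(2-\lambda_3)\lambda_3\big),\quad \nu_{33}=a_{33}\lambda_3,\\ \nu_{12}&=a_{21}\big(\lambda_2(1-\lambda_3)+(2-\lambda_3)\lambda_3\big)+a_{11}\big(\lambda_2(-2+\lambda_1+\lambda_2)+2(-1+\lambda_2)\lambda_3+\lambda_3^2\big),\\ \nu_{13}&=\lambda_3\big(a_{31}+a_{11}\lambda_1+a_{21}(-2+\lambda_2+\lambda_3)\big),\quad \nu_{23}=\lambda_3\big(a_{32}+a_{22}(-2+\lambda_2+\lambda_3)\big).\end{aligned}$$ *)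

theory Defs
  imports "HOL-Analysis.Analysis"
begin

text \<open>
  A Gelfand triple is presented by its embedding \<open>\<iota>\<close> of \<open>V\<close> into \<open>H\<close>, continuous and injective
  with dense range; the dual of \<open>V\<close> is the type \<open>'v \<Rightarrow>\<^sub>L real\<close>.
\<close>

definition gelfand_triple ::
    "('v::banach \<Rightarrow>\<^sub>L 'h::{real_inner, complete_space}) \<Rightarrow> bool" where
  "gelfand_triple \<iota> \<longleftrightarrow>
     separable_space (euclidean :: 'h topology) \<and>
     inj (blinfun_apply \<iota>) \<and> closure (range (blinfun_apply \<iota>)) = UNIV"

text \<open>The identification of \<open>h \<in> H\<close> with the functional \<open>w \<mapsto> (h, \<iota> w)\<close> on \<open>V\<close>.\<close>

definition to_dual ::
    "('v::real_normed_vector \<Rightarrow>\<^sub>L 'h::real_inner) \<Rightarrow> 'h \<Rightarrow> ('v \<Rightarrow>\<^sub>L real)" where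
  "to_dual \<iota> h = blinfun_inner_right h o\<^sub>L \<iota>"

lemma to_dual_apply: "blinfun_apply (to_dual \<iota> h) w = h \<bullet> blinfun_apply \<iota> w"
  by (simp add: to_dual_def)

definition nonneg_operator :: "('v::real_normed_vector \<Rightarrow> ('v \<Rightarrow>\<^sub>L real)) \<Rightarrow> bool" where
  "nonneg_operator \<A> \<longleftrightarrow> (\<forall>w. blinfun_apply (\<A> w) w \<ge> 0)"

definition locally_solvable ::
    "('v::real_normed_vector \<Rightarrow>\<^sub>L 'h::real_inner) \<Rightarrow> ('v \<Rightarrow> ('v \<Rightarrow>\<^sub>L real)) \<Rightarrow> bool" where
  "locally_solvable \<iota> \<A> \<longleftrightarrow>
     (\<forall>F. \<exists>\<beta>>0. \<forall>\<gamma>\<in>{0<..\<beta>}.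
        \<exists>!v. to_dual \<iota> (blinfun_apply \<iota> v) + \<gamma> *\<^sub>R \<A> v = F)"

definition is_partition :: "real \<Rightarrow> nat \<Rightarrow> (nat \<Rightarrow> real) \<Rightarrow> bool" where
  "is_partition T N t \<longleftrightarrow> t 0 = 0 \<and> t N = T \<and> (\<forall>n<N. t n < t (Suc n))"

definition step :: "(nat \<Rightarrow> real) \<Rightarrow> nat \<Rightarrow> real" where
  "step t n = t (Suc n) - t n"

text \<open>Stages, and hence tableau entries, are indexed from 1 to \<open>s\<close>.\<close>

definition dirk_tableau ::
    "nat \<Rightarrow> (nat \<Rightarrow> nat \<Rightarrow> real) \<Rightarrow> (nat \<Rightarrow> real) \<Rightarrow> (nat \<Rightarrow> real) \<Rightarrow> bool" where
  "dirk_tableau s a b c \<longleftrightarrow>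
     (\<forall>i\<in>{1..s}. b i \<in> {0..1} \<and> c i \<in> {0..1} \<and> (\<forall>j\<in>{1..s}. i < j \<longrightarrow> a i j = 0))"

definition stage_rhs ::
    "(real \<Rightarrow> ('v::real_normed_vector \<Rightarrow>\<^sub>L real)) \<Rightarrow> ('v \<Rightarrow> ('v \<Rightarrow>\<^sub>L real)) \<Rightarrow>
     (nat \<Rightarrow> real) \<Rightarrow> (nat \<Rightarrow> real) \<Rightarrow> (nat \<Rightarrow> nat \<Rightarrow> 'v) \<Rightarrow> nat \<Rightarrow> nat \<Rightarrow> ('v \<Rightarrow>\<^sub>L real)" where
  "stage_rhs f \<A> c t v n j = f (t n + c j * step t n) - \<A> (v n j)"

definition dirk_solution ::
    "('v::real_normed_vector \<Rightarrow>\<^sub>L 'h::real_inner) \<Rightarrow> (real \<Rightarrow> ('v \<Rightarrow>\<^sub>L real)) \<Rightarrow>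
     ('v \<Rightarrow> ('v \<Rightarrow>\<^sub>L real)) \<Rightarrow> nat \<Rightarrow> (nat \<Rightarrow> nat \<Rightarrow> real) \<Rightarrow> (nat \<Rightarrow> real) \<Rightarrow> (nat \<Rightarrow> real) \<Rightarrow>
     nat \<Rightarrow> (nat \<Rightarrow> real) \<Rightarrow> 'h \<Rightarrow> (nat \<Rightarrow> 'h) \<Rightarrow> (nat \<Rightarrow> nat \<Rightarrow> 'v) \<Rightarrow> bool" where
  "dirk_solution \<iota> f \<A> s a b c N t u0 u v \<longleftrightarrow>
     u 0 = u0 \<and>
     (\<forall>n<N.
        (\<forall>i\<in>{1..s}. to_dual \<iota> (blinfun_apply \<iota> (v n i)) =
           to_dual \<iota> (u n) + step t n *\<^sub>R (\<Sum>j=1..i. a i j *\<^sub>R stage_rhs f \<A> c t v n j)) \<and>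
        to_dual \<iota> (u (Suc n)) =
          to_dual \<iota> (u n) + step t n *\<^sub>R (\<Sum>j=1..s. b j *\<^sub>R stage_rhs f \<A> c t v n j))"

context
  fixes a :: "nat \<Rightarrow> nat \<Rightarrow> real" and b :: "nat \<Rightarrow> real"
begin

definition lam1 :: real where
  "lam1 = b 1 / a 1 1 - b 2 * a 2 1 / (a 1 1 * a 2 2) - b 3 * a 3 1 / (a 1 1 * a 3 3)
     + b 3 * a 3 2 * a 2 1 / (a 1 1 * a 2 2 * a 3 3)"

definition lam2 :: real where
  "lam2 = b 2 / a 2 2 - b 3 * a 3 2 / (a 2 2 * a 3 3)"

definition lam3 :: real where
  "lam3 = b 3 / a 3 3"

definition delta1 :: real where
  "delta1 = 1 / 2 * (lam1 + lam2 + lam3) * (2 - lam1 - lam2 - lam3)"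

definition delta2 :: real where
  "delta2 = 1 / 2 * (lam2 + lam3) * (2 - lam2 - lam3)"

definition delta3 :: real where
  "delta3 = 1 / 2 * lam3 * (2 - lam3)"

definition nu11 :: real where
  "nu11 = a 1 1 * (lam1 * (1 - lam2 - lam3) + (2 - lam2 - lam3) * (lam2 + lam3))"

definition nu22 :: real where
  "nu22 = a 2 2 * (lam2 * (1 - lam3) + (2 - lam3) * lam3)"

definition nu33 :: real where
  "nu33 = a 3 3 * lam3"

definition nu12 :: real where
  "nu12 = a 2 1 * (lam2 * (1 - lam3) + (2 - lam3) * lam3)
     + a 1 1 * (lam2 * (-2 + lam1 + lam2) + 2 * (-1 + lam2) * lam3 + lam3\<^sup>2)"

definition nu13 :: real where
  "nu13 = lam3 * (a 3 1 + a 1 1 * lam1 + a 2 1 * (-2 + lam2 + lam3))"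

definition nu23 :: real where
  "nu23 = lam3 * (a 3 2 + a 2 2 * (-2 + lam2 + lam3))"

definition nu_coeff :: "nat \<Rightarrow> nat \<Rightarrow> real" where
  "nu_coeff i j =
     (if (i, j) = (1, 1) then nu11 else if (i, j) = (2, 2) then nu22
      else if (i, j) = (3, 3) then nu33 else if (i, j) = (1, 2) then nu12
      else if (i, j) = (1, 3) then nu13 else if (i, j) = (2, 3) then nu23 else 0)"

definition nu :: "nat \<Rightarrow> real" where
  "nu i = nu_coeff i i + (\<Sum>j=i+1..3. nu_coeff i j)"

definition Q_form :: "'h::real_inner \<Rightarrow> 'h \<Rightarrow> 'h \<Rightarrow> 'h \<Rightarrow> real" where
  "Q_form u v1 v2 v3 =
     delta1 * (norm (v1 - u))\<^sup>2 + delta2 * (norm (v2 - v1))\<^sup>2 + delta3 * (norm (v3 - v2))\<^sup>2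
     - nu12 / a 1 1 * ((v1 - u) \<bullet> (v2 - v1))
     - nu13 / a 1 1 * ((v1 - u) \<bullet> (v3 - v1))
     - nu23 / a 2 2 * ((v2 - u) \<bullet> (v3 - v2))
     + nu23 * a 2 1 / (a 1 1 * a 2 2) * ((v1 - u) \<bullet> (v3 - v2))"

end

end

theory Submission
  imports Defs
begin

text \<open>
  Since \<open>V\<close> is dense in \<open>H\<close>, the embedding of \<open>H\<close> into the dual of \<open>V\<close> is injective. The diagonal
  coefficients of the tableau are nonzero, so the stage equations can be solved for the scaled stage
  derivatives \<open>\<tau> F\<^sub>i\<close>, which therefore lie in \<open>H\<close> although \<open>f\<close> and \<open>A(v)\<close> separately need
  not. Hence the scheme is an identity in \<open>H\<close>, and the duality pairings become inner products. What
  remains is an identity between quadratic forms in \<open>u\<^sub>n\<close> and the three stage derivatives, which is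
  polynomial once the weights are written as \<open>b = A\<^sup>T \<lambda>\<close>.
\<close>

text \<open>The continuous functional \<open>\<lambda>z. z \<bullet> (x - y)\<close> vanishes on the
  dense range of \<open>\<iota>\<close>, hence everywhere, in particular at \<open>x - y\<close>
  itself.\<close>

lemma gelfand_triple_to_dual_inj:
  assumes "gelfand_triple \<iota>"
  shows "inj (to_dual \<iota>)"
proof (rule injI)
  fix x y assume eq: "to_dual \<iota> x = to_dual \<iota> y"
  let ?R = "range (blinfun_apply \<iota>)"
  have zero: "z \<bullet> (x - y) = 0" if "z \<in> ?R" for z
    using that eq by (metis rangeE inner_commute inner_diff_left right_minus_eq to_dual_apply)
  have cont: "continuous_on (closure ?R) (\<lambda>z. z \<bullet> (x - y))"
    by (intro continuous_intros)
  have "x - y \<in> closure ?R"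
    using assms by (simp add: gelfand_triple_def)
  from continuous_constant_on_closure[OF cont zero this] have "(x - y) \<bullet> (x - y) = 0" .
  then show "x = y" by simp
qed

lemma to_dual_add: "to_dual \<iota> (x + y) = to_dual \<iota> x + to_dual \<iota> y"
  by (rule blinfun_eqI) (simp add: to_dual_apply plus_blinfun.rep_eq inner_add_left)

lemma to_dual_diff: "to_dual \<iota> (x - y) = to_dual \<iota> x - to_dual \<iota> y"
  by (rule blinfun_eqI) (simp add: to_dual_apply minus_blinfun.rep_eq inner_diff_left)

lemma to_dual_scaleR: "to_dual \<iota> (r *\<^sub>R x) = r *\<^sub>R to_dual \<iota> x"
  by (rule blinfun_eqI) (simp add: to_dual_apply scaleR_blinfun.rep_eq)

text \<open>The \<open>lam\<close> coefficients are the back substitution for the upper triangular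
  system with the transposed tableau as matrix. Substituting for the weights removes all divisions
  from the later identities.\<close>

lemma weights_eq_transpose_lam:
  assumes "a 1 1 \<noteq> 0" "a 2 2 \<noteq> 0" "a 3 3 \<noteq> 0"
  shows "b 1 = a 1 1 * lam1 a b + a 2 1 * lam2 a b + a 3 1 * lam3 a b"
    and "b 2 = a 2 2 * lam2 a b + a 3 2 * lam3 a b"
    and "b 3 = a 3 3 * lam3 a b"
  using assms by (simp_all add: lam1_def lam2_def lam3_def field_simps)

lemma nu_simps:
  "nu a b 1 = nu11 a b + nu12 a b + nu13 a b"
  "nu a b 2 = nu22 a b + nu23 a b"
  "nu a b 3 = nu33 a b"
  by (simp_all add: nu_def nu_coeff_def numeral_2_eq_2 numeral_3_eq_3)

text \<open>The two terms with \<open>nu23\<close> merge because \<open>g2\<close> equals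
  \<open>v2 - u\<close> over \<open>a 2 2\<close> minus \<open>a 2 1 / (a 1 1 * a 2 2)\<close> times
  \<open>v1 - u\<close>.\<close>

lemma Q_form_stage_derivatives:
  fixes u g1 g2 :: "'h::real_inner"
  assumes "a 1 1 \<noteq> 0" "a 2 2 \<noteq> 0"
    and w1: "v1 - u = a 1 1 *\<^sub>R g1"
    and w2: "v2 - u = a 2 1 *\<^sub>R g1 + a 2 2 *\<^sub>R g2"
  shows "Q_form a b u v1 v2 v3 =
     delta1 a b * (norm (v1 - u))\<^sup>2 + delta2 a b * (norm (v2 - v1))\<^sup>2
     + delta3 a b * (norm (v3 - v2))\<^sup>2
     - nu12 a b * (g1 \<bullet> (v2 - v1)) - nu13 a b * (g1 \<bullet> (v3 - v1)) - nu23 a b * (g2 \<bullet> (v3 - v2))"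
  unfolding Q_form_def w1 w2 using assms(1,2) by (simp add: inner_add_left field_simps)

text \<open>All terms quadratic in the \<open>lam\<close> coefficients cancel in the row sums, and
  the linear ones left over are the weights.\<close>

lemma nu_eq_weights:
  assumes "a 1 1 \<noteq> 0" "a 2 2 \<noteq> 0" "a 3 3 \<noteq> 0"
  shows "nu a b 1 = b 1" "nu a b 2 = b 2" "nu a b 3 = b 3"
  unfolding nu_simps nu11_def nu12_def nu13_def nu22_def nu23_def nu33_def
    weights_eq_transpose_lam[of a b, OF assms]
  by (algebra, algebra, rule refl)

text \<open>
  The left-hand sides are the coefficients of \<open>g\<^sub>i \<bullet> g\<^sub>j\<close> in the energy balance, where
  \<open>g\<^sub>i\<close> is the \<open>i\<close>-th scaled stage derivative.
\<close>

lemma energy_coefficients: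
  assumes nz: "a 1 1 \<noteq> 0" "a 2 2 \<noteq> 0" "a 3 3 \<noteq> 0"
  shows "(b 1)\<^sup>2 / 2 + delta1 a b * (a 1 1)\<^sup>2 + delta2 a b * (a 2 1 - a 1 1)\<^sup>2
      + delta3 a b * (a 3 1 - a 2 1)\<^sup>2 - nu12 a b * (a 2 1 - a 1 1)
      - nu13 a b * (a 3 1 - a 1 1) - b 1 * a 1 1 = 0"
    and "(b 2)\<^sup>2 / 2 + delta2 a b * (a 2 2)\<^sup>2 + delta3 a b * (a 3 2 - a 2 2)\<^sup>2
      - nu23 a b * (a 3 2 - a 2 2) - b 2 * a 2 2 = 0"
    and "(b 3)\<^sup>2 / 2 + delta3 a b * (a 3 3)\<^sup>2 - b 3 * a 3 3 = 0"
    and "b 1 * b 2 + 2 * delta2 a b * (a 2 1 - a 1 1) * a 2 2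
      + 2 * delta3 a b * (a 3 1 - a 2 1) * (a 3 2 - a 2 2) - nu12 a b * a 2 2
      - nu13 a b * a 3 2 - nu23 a b * (a 3 1 - a 2 1) - b 2 * a 2 1 = 0"
    and "b 1 * b 3 + 2 * delta3 a b * (a 3 1 - a 2 1) * a 3 3 - nu13 a b * a 3 3 - b 3 * a 3 1 = 0"
    and "b 2 * b 3 + 2 * delta3 a b * (a 3 2 - a 2 2) * a 3 3 - nu23 a b * a 3 3 - b 3 * a 3 2 = 0"
  unfolding delta1_def delta2_def delta3_def nu12_def nu13_def nu23_def
    weights_eq_transpose_lam[of a b, OF nz]
  by (simp_all add: field_simps power2_eq_square)

lemma energy_identity:
  fixes u g1 g2 g3 :: "'h::real_inner"
  assumes nz: "a 1 1 \<noteq> 0" "a 2 2 \<noteq> 0" "a 3 3 \<noteq> 0"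
    and v1: "v1 = u + a 1 1 *\<^sub>R g1"
    and v2: "v2 = u + a 2 1 *\<^sub>R g1 + a 2 2 *\<^sub>R g2"
    and v3: "v3 = u + a 3 1 *\<^sub>R g1 + a 3 2 *\<^sub>R g2 + a 3 3 *\<^sub>R g3"
    and u': "u' = u + b 1 *\<^sub>R g1 + b 2 *\<^sub>R g2 + b 3 *\<^sub>R g3"
  shows "1 / 2 * (norm u')\<^sup>2 + Q_form a b u v1 v2 v3
       - (nu a b 1 * (g1 \<bullet> v1) + nu a b 2 * (g2 \<bullet> v2) + nu a b 3 * (g3 \<bullet> v3))
     = 1 / 2 * (norm u)\<^sup>2" (is "?lhs = ?rhs")
proof -
  have w: "v1 - u = a 1 1 *\<^sub>R g1" "v2 - u = a 2 1 *\<^sub>R g1 + a 2 2 *\<^sub>R g2"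
    by (simp_all add: v1 v2)
  have d: "v2 - v1 = (a 2 1 - a 1 1) *\<^sub>R g1 + a 2 2 *\<^sub>R g2"
    "v3 - v1 = (a 3 1 - a 1 1) *\<^sub>R g1 + a 3 2 *\<^sub>R g2 + a 3 3 *\<^sub>R g3"
    "v3 - v2 = (a 3 1 - a 2 1) *\<^sub>R g1 + (a 3 2 - a 2 2) *\<^sub>R g2 + a 3 3 *\<^sub>R g3"
    by (simp_all add: v1 v2 v3 algebra_simps)
  have comm: "g1 \<bullet> u = u \<bullet> g1" "g2 \<bullet> u = u \<bullet> g2" "g3 \<bullet> u = u \<bullet> g3"
    "g2 \<bullet> g1 = g1 \<bullet> g2" "g3 \<bullet> g1 = g1 \<bullet> g3" "g3 \<bullet> g2 = g2 \<bullet> g3"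
    by (simp_all add: inner_commute)
  \<comment> \<open>The squares of \<open>u\<close> cancel, and so do its products with each
    \<open>g\<close> because \<open>nu\<close> equals \<open>b\<close>; \<open>Q_form\<close>
    depends on differences only.\<close>
  have "?lhs - ?rhs =
      ((b 1)\<^sup>2 / 2 + delta1 a b * (a 1 1)\<^sup>2 + delta2 a b * (a 2 1 - a 1 1)\<^sup>2
      + delta3 a b * (a 3 1 - a 2 1)\<^sup>2 - nu12 a b * (a 2 1 - a 1 1)
      - nu13 a b * (a 3 1 - a 1 1) - b 1 * a 1 1) * (g1 \<bullet> g1)
    + ((b 2)\<^sup>2 / 2 + delta2 a b * (a 2 2)\<^sup>2 + delta3 a b * (a 3 2 - a 2 2)\<^sup>2
      - nu23 a b * (a 3 2 - a 2 2) - b 2 * a 2 2) * (g2 \<bullet> g2)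
    + ((b 3)\<^sup>2 / 2 + delta3 a b * (a 3 3)\<^sup>2 - b 3 * a 3 3) * (g3 \<bullet> g3)
    + (b 1 * b 2 + 2 * delta2 a b * (a 2 1 - a 1 1) * a 2 2
      + 2 * delta3 a b * (a 3 1 - a 2 1) * (a 3 2 - a 2 2) - nu12 a b * a 2 2
      - nu13 a b * a 3 2 - nu23 a b * (a 3 1 - a 2 1) - b 2 * a 2 1) * (g1 \<bullet> g2)
    + (b 1 * b 3 + 2 * delta3 a b * (a 3 1 - a 2 1) * a 3 3 - nu13 a b * a 3 3 - b 3 * a 3 1)
      * (g1 \<bullet> g3)
    + (b 2 * b 3 + 2 * delta3 a b * (a 3 2 - a 2 2) * a 3 3 - nu23 a b * a 3 3 - b 3 * a 3 2)
      * (g2 \<bullet> g3)"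
    unfolding Q_form_stage_derivatives[of a, OF nz(1,2) w] d w(1) nu_eq_weights[of a, OF nz]
    unfolding u' v1 v2 v3 power2_norm_eq_inner inner_add_left inner_add_right
      inner_scaleR_left inner_scaleR_right comm
    by (simp add: power2_eq_square algebra_simps)
  then show ?thesis
    unfolding energy_coefficients[of a, OF nz] by simp
qed

theorem corollary5p5:
  fixes \<iota> :: "'v::banach \<Rightarrow>\<^sub>L 'h::{real_inner, complete_space}"
    and f :: "real \<Rightarrow> ('v \<Rightarrow>\<^sub>L real)"
    and \<A> :: "'v \<Rightarrow> ('v \<Rightarrow>\<^sub>L real)"
    and a :: "nat \<Rightarrow> nat \<Rightarrow> real"
    and b c t :: "nat \<Rightarrow> real"
    and t_f :: real
    and u0 :: 'h
    and u :: "nat \<Rightarrow> 'h"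
    and v :: "nat \<Rightarrow> nat \<Rightarrow> 'v"
    and N n :: nat
  assumes "gelfand_triple \<iota>"
    and "nonneg_operator \<A>"
    and "locally_solvable \<iota> \<A>"
    and "t_f > 0"
    and "is_partition t_f N t"
    and "dirk_tableau 3 a b c"
    and "\<forall>i\<in>{1..3}. a i i > 0"
    and "dirk_solution \<iota> f \<A> 3 a b c N t u0 u v"
    and "n < N"
  shows "1 / 2 * (norm (u (Suc n)))\<^sup>2
       + Q_form a b (u n) (blinfun_apply \<iota> (v n 1)) (blinfun_apply \<iota> (v n 2)) (blinfun_apply \<iota> (v n 3))
       - step t n * (\<Sum>i=1..3. nu a b i * blinfun_apply (stage_rhs f \<A> c t v n i) (v n i))
     = 1 / 2 * (norm (u n))\<^sup>2"
proof -
  let ?\<tau> = "step t n" and ?F = "stage_rhs f \<A> c t v n" and ?v = "\<lambda>i. blinfun_apply \<iota> (v n i)"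
  have nz: "a 1 1 \<noteq> 0" "a 2 2 \<noteq> 0" "a 3 3 \<noteq> 0"
    using assms(7)[rule_format, of 1] assms(7)[rule_format, of 2] assms(7)[rule_format, of 3]
    by simp_all
  have inj: "to_dual \<iota> x = to_dual \<iota> y \<Longrightarrow> x = y" for x y
    using gelfand_triple_to_dual_inj[OF assms(1)] by (rule injD)
  have sum_simps: "(\<Sum>j=1..1. x j) = x 1" "(\<Sum>j=1..2. x j) = x 1 + x 2"
    "(\<Sum>j=1..3. x j) = x 1 + x 2 + x 3" for x :: "nat \<Rightarrow> 'b::comm_monoid_add"
    by (simp_all add: numeral_2_eq_2 numeral_3_eq_3 add.assoc)
  have stage: "to_dual \<iota> (?v i) = to_dual \<iota> (u n) + ?\<tau> *\<^sub>R (\<Sum>j=1..i. a i j *\<^sub>R ?F j)"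
    if "i \<in> {1..3}" for i
    using assms(8,9) that unfolding dirk_solution_def by blast
  have final: "to_dual \<iota> (u (Suc n)) = to_dual \<iota> (u n) + ?\<tau> *\<^sub>R (\<Sum>j=1..3. b j *\<^sub>R ?F j)"
    using assms(8,9) unfolding dirk_solution_def by blast
  have s1: "to_dual \<iota> (?v 1) = to_dual \<iota> (u n) + a 1 1 *\<^sub>R (?\<tau> *\<^sub>R ?F 1)"
    using stage[of 1] by simp
  have s2: "to_dual \<iota> (?v 2) =
      to_dual \<iota> (u n) + a 2 1 *\<^sub>R (?\<tau> *\<^sub>R ?F 1) + a 2 2 *\<^sub>R (?\<tau> *\<^sub>R ?F 2)"
    using stage[of 2] unfolding sum_simps by (simp add: algebra_simps)
  have s3: "to_dual \<iota> (?v 3) = to_dual \<iota> (u n) + a 3 1 *\<^sub>R (?\<tau> *\<^sub>R ?F 1)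
      + a 3 2 *\<^sub>R (?\<tau> *\<^sub>R ?F 2) + a 3 3 *\<^sub>R (?\<tau> *\<^sub>R ?F 3)"
    using stage[of 3] unfolding sum_simps by (simp add: algebra_simps)
  \<comment> \<open>Forward substitution in the lower triangular stage system, carried out in
    H.\<close>
  define g1 where "g1 = (1 / a 1 1) *\<^sub>R (?v 1 - u n)"
  define g2 where "g2 = (1 / a 2 2) *\<^sub>R (?v 2 - u n - a 2 1 *\<^sub>R g1)"
  define g3 where "g3 = (1 / a 3 3) *\<^sub>R (?v 3 - u n - a 3 1 *\<^sub>R g1 - a 3 2 *\<^sub>R g2)"
  have G1: "to_dual \<iota> g1 = ?\<tau> *\<^sub>R ?F 1"
    unfolding g1_def to_dual_scaleR to_dual_diff s1 using nz by simp
  have G2: "to_dual \<iota> g2 = ?\<tau> *\<^sub>R ?F 2"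
    unfolding g2_def to_dual_scaleR to_dual_diff s2 G1 using nz by simp
  have G3: "to_dual \<iota> g3 = ?\<tau> *\<^sub>R ?F 3"
    unfolding g3_def to_dual_scaleR to_dual_diff s3 G1 G2 using nz by simp
  \<comment> \<open>Read backwards, \<open>to_dual_apply\<close> turns an inner product with
    \<open>?v i\<close> into a functional evaluated at \<open>v n i\<close>.\<close>
  have pair: "g1 \<bullet> ?v 1 = ?\<tau> * ?F 1 (v n 1)" "g2 \<bullet> ?v 2 = ?\<tau> * ?F 2 (v n 2)"
    "g3 \<bullet> ?v 3 = ?\<tau> * ?F 3 (v n 3)"
    unfolding to_dual_apply[symmetric] G1 G2 G3 by (simp_all add: scaleR_blinfun.rep_eq)
  have "?v 1 = u n + a 1 1 *\<^sub>R g1" "?v 2 = u n + a 2 1 *\<^sub>R g1 + a 2 2 *\<^sub>R g2"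
    "?v 3 = u n + a 3 1 *\<^sub>R g1 + a 3 2 *\<^sub>R g2 + a 3 3 *\<^sub>R g3"
    using nz by (simp_all add: g1_def g2_def g3_def)
  \<comment> \<open>The stages have their form by the choice of the \<open>g\<close> vectors; the
    update is given only in the dual and is pulled back to H by injectivity.\<close>
  moreover have "u (Suc n) = u n + b 1 *\<^sub>R g1 + b 2 *\<^sub>R g2 + b 3 *\<^sub>R g3"
    by (rule inj, unfold final sum_simps to_dual_add to_dual_scaleR G1 G2 G3)
      (simp add: algebra_simps)
  ultimately have "1 / 2 * (norm (u (Suc n)))\<^sup>2 + Q_form a b (u n) (?v 1) (?v 2) (?v 3)
       - (nu a b 1 * (g1 \<bullet> ?v 1) + nu a b 2 * (g2 \<bullet> ?v 2) + nu a b 3 * (g3 \<bullet> ?v 3))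
     = 1 / 2 * (norm (u n))\<^sup>2"
    by (rule energy_identity[of a, OF nz])
  then show ?thesis
    unfolding pair sum_simps by (simp add: algebra_simps)
qed

end
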